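(* Let $A$ be an infinite set of cardinality $\nu$. Then the closure operator $\Lambda_\omega\langle-\rangle\colon\mathcal{P}(\mathcal{O}_A)\to\mathcal{P}(\mathcal{O}_A)$, $F\mapsto\Lambda_\omega(\langle F\rangle)$, is not $\kappa$-algebraic for any infinite regular cardinal $\kappa\le\nu$.
   Context: A clone on a nonempty set $A$ is a set of finitary operations on $A$ that contains all projections and is closed under composition; $\mathcal{O}_A$ is the clone of all finitary operations on $A$ and $\langle F\rangle$ is the clone generated by $F$. An $n$-ary operation $f$ on $A$ is $\lambda$-interpolable by a clone $\mathcal{C}$ if for every $S\subseteq A^n$ with $|S|\le\lambda$ there is an $n$-ary $t\in\mathcal{C}$ with $f|_S=t|_S$. The local closure $\Lambda_\omega(\mathcal{C})$ is the set of all operations on $A$ that are $\lambda$-interpolable by $\mathcal{C}$ for every finite $\lambda$ (it is the least locally closed clone containing $\mathcal{C}$). For an infinite cardinal $\kappa$, a closure operator $X\mapsto\bar X$ on a set $S$ is $\kappa$-algebraic if for every $X\subseteq S$: $X=\bar X$ iff $X=\bigcup\{\bar Y: Y\subseteq X,\ |Y|<\kappa\}$. *)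

theory Defs
  imports Main "HOL-Library.FuncSet" "HOL-Library.NList"
begin

unbundle cardinal_syntax

text \<open>
  An \<open>n\<close>-ary operation on \<open>A\<close> is a pair \<open>(n, f)\<close>, where \<open>f\<close> maps the \<open>n\<close>-tuples over \<open>A\<close>
  (lists of length \<open>n\<close>) into \<open>A\<close> and is \<^const>\<open>undefined\<close> on all other lists. Hence equality
  of pairs is equality of operations. Every arity \<open>n\<close> is allowed, including \<open>n = 0\<close>.
\<close>

type_synonym 'a operation = "nat \<times> ('a list \<Rightarrow> 'a)"

definition all_operations :: "'a set \<Rightarrow> 'a operation set" where
  "all_operations A = {(n, f). f \<in> nlists n A \<rightarrow>\<^sub>E A}"

definition projection :: "'a set \<Rightarrow> nat \<Rightarrow> nat \<Rightarrow> 'a operation" where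
  "projection A n i = (n, \<lambda>xs \<in> nlists n A. xs ! i)"

text \<open>
  The \<open>k\<close>-ary operation \<open>f(g\<^sub>1, \<dots>, g\<^sub>n)\<close>. The arity \<open>k\<close> has to be given separately
  because the list \<open>gs\<close> is empty if \<open>f\<close> is nullary.
\<close>

definition composition ::
    "'a set \<Rightarrow> nat \<Rightarrow> ('a list \<Rightarrow> 'a) \<Rightarrow> ('a list \<Rightarrow> 'a) list \<Rightarrow> 'a operation" where
  "composition A k f gs = (k, \<lambda>xs \<in> nlists k A. f (map (\<lambda>g. g xs) gs))"

definition clone_on :: "'a set \<Rightarrow> 'a operation set \<Rightarrow> bool" where
  "clone_on A C \<longleftrightarrow>
     C \<subseteq> all_operations A \<and>
     (\<forall>n. \<forall>i<n. projection A n i \<in> C) \<and>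
     (\<forall>n k f gs. (n, f) \<in> C \<and> length gs = n \<and> (\<forall>g \<in> set gs. (k, g) \<in> C)
        \<longrightarrow> composition A k f gs \<in> C)"

definition generated_clone :: "'a set \<Rightarrow> 'a operation set \<Rightarrow> 'a operation set" where
  "generated_clone A F = \<Inter> {C. clone_on A C \<and> F \<subseteq> C}"

definition interpolable ::
    "'a set \<Rightarrow> 'l rel \<Rightarrow> 'a operation set \<Rightarrow> nat \<Rightarrow> ('a list \<Rightarrow> 'a) \<Rightarrow> bool" where
  "interpolable A \<mu> C n f \<longleftrightarrow>
     (\<forall>S \<subseteq> nlists n A. |S| \<le>o \<mu> \<longrightarrow> (\<exists>t. (n, t) \<in> C \<and> (\<forall>xs \<in> S. f xs = t xs)))"

text \<open>The finite cardinals \<open>\<mu>\<close> are represented by \<open>|{..<m}|\<close> for natural numbers \<open>m\<close>.\<close>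

definition local_closure :: "'a set \<Rightarrow> 'a operation set \<Rightarrow> 'a operation set" where
  "local_closure A C =
     {(n, f) \<in> all_operations A. \<forall>m::nat. interpolable A |{..<m}| C n f}"

text \<open>
  That \<open>cl\<close> is a closure operator on \<open>S\<close> is deliberately not part of the following predicate,
  so that its negation asserts failure of the stated equivalence and nothing else.
\<close>

definition algebraic_on :: "'k rel \<Rightarrow> 'b set \<Rightarrow> ('b set \<Rightarrow> 'b set) \<Rightarrow> bool" where
  "algebraic_on \<kappa> S cl \<longleftrightarrow>
     (\<forall>X \<subseteq> S. X = cl X \<longleftrightarrow> X = \<Union> {cl Y | Y. Y \<subseteq> X \<and> |Y| <o \<kappa>})"

end

theory Submission
  imports Defs
begin

text \<open>
  Let \<open>X\<close> consist of the operations \<open>f\<close> for which \<open>f(x, \<dots>, x) = x\<close> holds for all but fewer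
  than \<open>\<kappa>\<close> elements \<open>x\<close>. If \<open>Y \<subseteq> X\<close> has fewer than \<open>\<kappa>\<close> elements, then by regularity the
  exceptional points of all members of \<open>Y\<close> form a set \<open>U\<close> with \<open>|U| < \<kappa>\<close>. The operations that
  are idempotent at every point outside \<open>U\<close> form a locally closed clone between \<open>Y\<close> and \<open>X\<close>,
  so the closure of \<open>Y\<close> lies in \<open>X\<close>. However, \<open>X\<close> is not closed: a unary constant operation
  is not in \<open>X\<close>, but on each finite set it agrees with an operation that is the identity elsewhere.
\<close>

definition nonidempotent_points :: "'a set \<Rightarrow> 'a operation \<Rightarrow> 'a set" where
  "nonidempotent_points A p = {x \<in> A. snd p (replicate (fst p) x) \<noteq> x}"

text \<open>For arity 0, \<open>replicate 0 x\<close> is the empty list, so idempotence at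
  \<open>x\<close> means that the value is \<open>x\<close>. An empty \<open>gs\<close> thus needs
  no separate case in a composition.\<close>

definition idempotent_operations :: "'a set \<Rightarrow> 'a set \<Rightarrow> 'a operation set" where
  "idempotent_operations A D = {p \<in> all_operations A. nonidempotent_points A p \<inter> D = {}}"

lemma generated_clone_superset: "F \<subseteq> generated_clone A F"
  unfolding generated_clone_def by blast

lemma generated_clone_least: "clone_on A C \<Longrightarrow> F \<subseteq> C \<Longrightarrow> generated_clone A F \<subseteq> C"
  unfolding generated_clone_def by blast

lemma local_closure_mono: "C \<subseteq> D \<Longrightarrow> local_closure A C \<subseteq> local_closure A D"
  unfolding local_closure_def interpolable_def by blast

lemma local_closure_superset: "C \<subseteq> all_operations A \<Longrightarrow> C \<subseteq> local_closure A C"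
  unfolding local_closure_def interpolable_def by blast

text \<open>On a constant tuple of some \<open>x \<in> D\<close> every inner operation returns
  \<open>x\<close>, so the outer one again receives a constant tuple of \<open>x\<close>.\<close>

lemma clone_on_idempotent_operations:
  assumes "D \<subseteq> A"
  shows "clone_on A (idempotent_operations A D)"
proof -
  have proj: "projection A n i \<in> idempotent_operations A D" if "i < n" for n i
    using that
    by (auto simp: idempotent_operations_def all_operations_def projection_def
        nonidempotent_points_def nlistsE_nth_in)
  have comp: "composition A k f gs \<in> idempotent_operations A D"
    if f: "(length gs, f) \<in> idempotent_operations A D"
      and gs: "\<forall>g \<in> set gs. (k, g) \<in> idempotent_operations A D" for k f gs
  proof -
    have "map (\<lambda>g. g xs) gs \<in> nlists (length gs) A" if "xs \<in> nlists k A" for xs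
      using gs that by (auto simp: idempotent_operations_def all_operations_def)
    then have "composition A k f gs \<in> all_operations A"
      using f by (auto simp: idempotent_operations_def all_operations_def composition_def)
    moreover have "f (map (\<lambda>g. g (replicate k x)) gs) = x" if "x \<in> D" for x
    proof -
      have "map (\<lambda>g. g (replicate k x)) gs = replicate (length gs) x"
        using gs that assms
        by (auto simp: idempotent_operations_def nonidempotent_points_def map_replicate_const[symmetric])
      then show ?thesis
        using f that assms by (auto simp: idempotent_operations_def nonidempotent_points_def)
    qed
    ultimately show ?thesis
      by (auto simp: idempotent_operations_def nonidempotent_points_def composition_def)
  qed
  show ?thesis
    unfolding clone_on_def using proj comp by (auto simp: idempotent_operations_def)
qed

text \<open>Idempotence at \<open>x\<close> concerns the value at a single tuple, so interpolation
  on one-element sets already transfers it.\<close>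

lemma local_closure_idempotent_operations:
  assumes "D \<subseteq> A"
  shows "local_closure A (idempotent_operations A D) \<subseteq> idempotent_operations A D"
proof
  fix p assume p: "p \<in> local_closure A (idempotent_operations A D)"
  obtain n f where nf: "p = (n, f)" by (cases p)
  have "f (replicate n x) = x" if x: "x \<in> D" for x
  proof -
    have "|{replicate n x}| \<le>o |{..<1::nat}|"
      by (intro card_of_singl_ordLeq) auto
    moreover have "{replicate n x} \<subseteq> nlists n A"
      using x assms by auto
    moreover have "interpolable A |{..<1::nat}| (idempotent_operations A D) n f"
      using p nf by (auto simp: local_closure_def)
    ultimately obtain t where "(n, t) \<in> idempotent_operations A D"
      and "f (replicate n x) = t (replicate n x)"
      unfolding interpolable_def by blast
    then show ?thesis
      using x assms by (auto simp: idempotent_operations_def nonidempotent_points_def)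
  qed
  then show "p \<in> idempotent_operations A D"
    using p nf
    by (auto simp: local_closure_def idempotent_operations_def nonidempotent_points_def)
qed

theorem theorem6p3:
  fixes A :: "'a set" and \<kappa> :: "'k rel"
  assumes "infinite A"
    and "Cinfinite \<kappa>" and "regularCard \<kappa>"
    and "\<kappa> \<le>o |A|"
  shows "\<not> algebraic_on \<kappa> (all_operations A)
             (\<lambda>F. local_closure A (generated_clone A F))"
proof
  let ?cl = "\<lambda>F. local_closure A (generated_clone A F)"
  assume alg: "algebraic_on \<kappa> (all_operations A) ?cl"
  define X where "X = {p \<in> all_operations A. |nonidempotent_points A p| <o \<kappa>}"
  have finite_less: "|S| <o \<kappa>" if "finite S" for S :: "'b set"
    using that assms(2) unfolding cinfinite_def
    by (metis card_of_well_order_on Field_card_of card_order_on_well_order_on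
        finite_ordLess_infinite)
  \<comment> \<open>This bounds generated clones by \<open>all_operations A\<close>, as
    \<open>local_closure_superset\<close> requires.\<close>
  have clone_all: "clone_on A (all_operations A)"
    using clone_on_idempotent_operations[of "{}" A] by (simp add: idempotent_operations_def)
  have cl_superset: "F \<subseteq> ?cl F" if "F \<subseteq> all_operations A" for F
    using generated_clone_superset
      local_closure_superset[OF generated_clone_least[OF clone_all that]] by (rule order_trans)
  have "?cl Y \<subseteq> X" if Y: "Y \<subseteq> X" "|Y| <o \<kappa>" for Y
  proof -
    define U where "U = (\<Union>p\<in>Y. nonidempotent_points A p)"
    \<comment> \<open>Regularity enters here: fewer than \<open>\<kappa>\<close> sets, each of size
      below \<open>\<kappa>\<close>, are united.\<close>
    have U: "|U| <o \<kappa>"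
      unfolding U_def using Y by (intro regularCard_UNION_bound assms) (auto simp: X_def)
    have "Y \<subseteq> idempotent_operations A (A - U)"
      using Y(1) by (auto simp: X_def U_def idempotent_operations_def)
    then have "?cl Y \<subseteq> local_closure A (idempotent_operations A (A - U))"
      by (intro local_closure_mono generated_clone_least clone_on_idempotent_operations) auto
    also have "\<dots> \<subseteq> idempotent_operations A (A - U)"
      by (intro local_closure_idempotent_operations) auto
    also have "\<dots> \<subseteq> X"
    proof
      fix p assume p: "p \<in> idempotent_operations A (A - U)"
      then have "nonidempotent_points A p \<subseteq> U"
        by (auto simp: idempotent_operations_def nonidempotent_points_def)
      then have "|nonidempotent_points A p| <o \<kappa>"
        using U card_of_mono1 ordLeq_ordLess_trans by blast
      then show "p \<in> X"
        using p by (simp add: X_def idempotent_operations_def)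
    qed
    finally show ?thesis .
  qed
  \<comment> \<open>Singletons \<open>Y\<close> already cover \<open>X\<close>, which gives the
    reverse inclusion.\<close>
  moreover have "p \<in> ?cl {p} \<and> {p} \<subseteq> X \<and> |{p}| <o \<kappa>" if "p \<in> X" for p
    using that cl_superset[of "{p}"] finite_less[of "{p}"] by (auto simp: X_def)
  ultimately have "X = \<Union> {?cl Y | Y. Y \<subseteq> X \<and> |Y| <o \<kappa>}"
    by blast
  then have closed: "X = ?cl X"
    using alg unfolding algebraic_on_def X_def by blast

  obtain c where c: "c \<in> A" using assms(1) by fastforce
  define const where "const = (\<lambda>xs \<in> nlists 1 A. c)"
  have const_op: "(1, const) \<in> all_operations A"
    using c by (auto simp: all_operations_def const_def)
  have "\<exists>t. (1, t) \<in> generated_clone A X \<and> (\<forall>xs\<in>S. const xs = t xs)"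
    if S: "S \<subseteq> nlists 1 A" "|S| \<le>o |{..<m::nat}|" for S m
  proof -
    have fin: "finite S"
      using S(2) card_of_ordLeq_infinite by blast
    \<comment> \<open>Constant on \<open>S\<close> and the identity elsewhere, so exceptional points
      occur only among the finitely many entries of tuples in \<open>S\<close>.\<close>
    define t where "t = (\<lambda>xs \<in> nlists 1 A. if xs \<in> S then c else hd xs)"
    have "(1, t) \<in> all_operations A"
      using c by (auto simp: all_operations_def t_def nlists_Suc)
    moreover have "nonidempotent_points A (1, t) \<subseteq> hd ` S"
      by (auto simp: nonidempotent_points_def t_def image_iff split: if_splits) force
    then have "|nonidempotent_points A (1, t)| <o \<kappa>"
      using fin finite_less finite_subset by blast
    ultimately have "(1, t) \<in> X"
      unfolding X_def by blast
    then have "(1, t) \<in> generated_clone A X"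
      using generated_clone_superset by blast
    moreover have "\<forall>xs\<in>S. const xs = t xs"
      using S(1) by (auto simp: const_def t_def)
    ultimately show ?thesis by blast
  qed
  then have "(1, const) \<in> ?cl X"
    using const_op by (auto simp: local_closure_def interpolable_def)
  then have "|nonidempotent_points A (1, const)| <o \<kappa>"
    using closed by (auto simp: X_def)
  \<comment> \<open>Only \<open>c\<close> is fixed by \<open>const\<close>. Adding this one point
    back keeps the size below the infinite \<open>\<kappa>\<close>, against
    \<open>\<kappa> \<le>o |A|\<close>.\<close>
  moreover have "nonidempotent_points A (1, const) = A - {c}"
    by (auto simp: nonidempotent_points_def const_def)
  ultimately have "|A - {c}| <o \<kappa>" by simp
  then have "|(A - {c}) \<union> {c}| <o \<kappa>"
    using assms(2) finite_less[of "{c}"]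
    by (intro card_of_Un_ordLess_infinite_Field) (auto simp: cinfinite_def)
  then have "|A| <o \<kappa>"
    using c by (simp add: insert_absorb)
  then show False
    using assms(4) not_ordLess_ordLeq by blast
qed

end
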